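(* Let $R$ be a finite commutative ring with identity, written as a direct sum of local rings $R = R_1\oplus\cdots\oplus R_n$, where $R_i$ has unique maximal ideal $M_i$, $m_i=|M_i|$ and $q_i=|R_i/M_i|$. Let $R^{**}$ be the set of exceptional units of $R$. Then $$|R^{**}| = \prod_{i=1}^n m_i(q_i-2).$$
   Context: A unit $u$ of a commutative ring $R$ with identity is called exceptional if $1-u$ is also a unit; $R^{**}$ denotes the set of exceptional units. Every finite commutative ring with identity is uniquely a direct sum of finite local rings. *)

theory Defs
  imports "HOL-Algebra.Chinese_Remainder" "HOL-Algebra.QuotRing"
begin

definition exceptional_units :: "('a, 'm) ring_scheme \<Rightarrow> 'a set" where
  "exceptional_units R = {u \<in> Units R. \<one>\<^bsub>R\<^esub> \<ominus>\<^bsub>R\<^esub> u \<in> Units R}"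

text \<open>No finiteness is built in. The zero ring has no maximal ideal, hence is not local.\<close>

definition local_ring :: "('a, 'm) ring_scheme \<Rightarrow> bool" where
  "local_ring R \<longleftrightarrow> cring R \<and> (\<exists>!M. maximalideal M R)"

end

theory Submission
  imports Defs
begin

text \<open>In a finite local ring with maximal ideal \<open>M\<close> the units are exactly the elements outside \<open>M\<close>,
  so the exceptional units are the complement of the two disjoint cosets \<open>M\<close> and \<open>1 + M\<close>.
  By Lagrange's theorem there are \<open>|R| - 2 |M| = |M| (|R/M| - 2)\<close> of them. Units, and hence
  exceptional units, of a direct product are computed componentwise.\<close>

text \<open>The condition becomes symmetric and free of subtraction: it involves only addition, 1
  and units. In this form it can be carried along isomorphisms and read off componentwise in
  products.\<close>

lemma (in ring) exceptional_units_eq_sum_one: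
  "exceptional_units R = {u \<in> Units R. \<exists>v \<in> Units R. u \<oplus> v = \<one>}"
proof -
  have "\<one> \<ominus> u \<in> Units R \<longleftrightarrow> (\<exists>v \<in> Units R. u \<oplus> v = \<one>)" if u: "u \<in> carrier R" for u
  proof
    assume "\<one> \<ominus> u \<in> Units R"
    moreover have "u \<oplus> (\<one> \<ominus> u) = \<one>"
      using u by (metis a_comm a_minus_def add.inv_closed add.inv_solve_right' one_closed minus_closed)
    ultimately show "\<exists>v \<in> Units R. u \<oplus> v = \<one>" by blast
  next
    assume "\<exists>v \<in> Units R. u \<oplus> v = \<one>"
    then obtain v where v: "v \<in> Units R" "u \<oplus> v = \<one>" by blast
    have "\<one> \<ominus> u = v"
      unfolding v(2)[symmetric] using u Units_closed[OF v(1)]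
      by (simp add: a_minus_def a_comm r_neg1)
    with v show "\<one> \<ominus> u \<in> Units R" by simp
  qed
  then show ?thesis
    unfolding exceptional_units_def by blast
qed

lemma ring_iso_Units_iff:
  assumes "ring R" "ring S" and h: "h \<in> ring_iso R S" and u: "u \<in> carrier R"
  shows "h u \<in> Units S \<longleftrightarrow> u \<in> Units R"
proof -
  interpret R: ring R by fact
  interpret S: ring S by fact
  have inj: "inj_on h (carrier R)" and surj: "h ` carrier R = carrier S"
    using ring_iso_memE(5)[OF h] by (auto simp: bij_betw_def)
  \<comment> \<open>Injectivity is what lets \<open>h\<close> reflect the equation for inverses, not
    merely preserve it.\<close>
  have mult: "h x \<otimes>\<^bsub>S\<^esub> h y = \<one>\<^bsub>S\<^esub> \<longleftrightarrow> x \<otimes>\<^bsub>R\<^esub> y = \<one>\<^bsub>R\<^esub>"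
    if "x \<in> carrier R" "y \<in> carrier R" for x y
    using inj_onD[OF inj, of "x \<otimes>\<^bsub>R\<^esub> y" "\<one>\<^bsub>R\<^esub>"]
      ring_iso_memE(2)[OF h that] ring_iso_memE(4)[OF h] that by auto
  \<comment> \<open>Writing the carrier of \<open>S\<close> as the image of \<open>h\<close> makes
    every candidate inverse of \<open>h u\<close> the image of a candidate inverse of
    \<open>u\<close>.\<close>
  have "h u \<in> Units S \<longleftrightarrow>
      (\<exists>y \<in> h ` carrier R. y \<otimes>\<^bsub>S\<^esub> h u = \<one>\<^bsub>S\<^esub> \<and> h u \<otimes>\<^bsub>S\<^esub> y = \<one>\<^bsub>S\<^esub>)"
    using ring_iso_memE(1)[OF h u] by (simp add: Units_def surj)
  also have "\<dots> \<longleftrightarrow> u \<in> Units R"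
    using u mult by (simp add: Units_def)
  finally show ?thesis .
qed

lemma card_exceptional_units_ring_iso:
  assumes "ring R" "ring S" and h: "h \<in> ring_iso R S"
  shows "card (exceptional_units R) = card (exceptional_units S)"
proof -
  interpret R: ring R by fact
  interpret S: ring S by fact
  have bij: "bij_betw h (carrier R) (carrier S)"
    using ring_iso_memE(5)[OF h] .
  have sub: "exceptional_units R \<subseteq> carrier R"
    by (auto simp: exceptional_units_def)
  have Units: "Units S = h ` Units R"
  proof (intro equalityI subsetI)
    fix y assume y: "y \<in> Units S"
    then have "y \<in> h ` carrier R"
      using bij_betw_imp_surj_on[OF bij] by auto
    with y show "y \<in> h ` Units R"
      using ring_iso_Units_iff[OF assms] by auto
  next
    fix y assume "y \<in> h ` Units R"
    then show "y \<in> Units S"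
      using ring_iso_Units_iff[OF assms] by auto
  qed
  have "h u \<oplus>\<^bsub>S\<^esub> h v = \<one>\<^bsub>S\<^esub> \<longleftrightarrow> u \<oplus>\<^bsub>R\<^esub> v = \<one>\<^bsub>R\<^esub>" if "u \<in> Units R" "v \<in> Units R" for u v
  proof -
    have c: "u \<in> carrier R" "v \<in> carrier R" using that by auto
    show ?thesis
      using inj_onD[OF bij_betw_imp_inj_on[OF bij], of "u \<oplus>\<^bsub>R\<^esub> v" "\<one>\<^bsub>R\<^esub>"]
        ring_iso_memE(3)[OF h c] ring_iso_memE(4)[OF h] c by auto
  qed
  then have "exceptional_units S = h ` exceptional_units R"
    unfolding R.exceptional_units_eq_sum_one S.exceptional_units_eq_sum_one Units by blast
  then show ?thesis
    using card_image[OF inj_on_subset[OF bij_betw_imp_inj_on[OF bij] sub]] by simp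
qed

lemma exceptional_units_RDirProd:
  assumes "ring R" "ring S"
  shows "exceptional_units (RDirProd R S) = exceptional_units R \<times> exceptional_units S"
proof -
  have Units: "Units (RDirProd R S) = Units R \<times> Units S"
    by (auto simp: Units_def RDirProd_def DirProd_def monoid.defs)
  have sum: "(u, u') \<oplus>\<^bsub>RDirProd R S\<^esub> (v, v') = \<one>\<^bsub>RDirProd R S\<^esub> \<longleftrightarrow>
      u \<oplus>\<^bsub>R\<^esub> v = \<one>\<^bsub>R\<^esub> \<and> u' \<oplus>\<^bsub>S\<^esub> v' = \<one>\<^bsub>S\<^esub>" for u u' v v'
    by (auto simp: RDirProd_def DirProd_def monoid.defs)
  show ?thesis
    unfolding ring.exceptional_units_eq_sum_one[OF assms(1)]
      ring.exceptional_units_eq_sum_one[OF assms(2)]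
      ring.exceptional_units_eq_sum_one[OF RDirProd_ring[OF assms]] Units
    by (auto simp: sum)
qed

lemma card_exceptional_units_RDirProd_list:
  fixes Rs :: "('c, 'm) ring_scheme list"
  assumes "\<And>i. i < length Rs \<Longrightarrow> ring (Rs ! i)"
  shows "card (exceptional_units (RDirProd_list Rs)) = (\<Prod>i<length Rs. card (exceptional_units (Rs ! i)))"
  using assms
proof (induction Rs)
  case Nil
  interpret ring "nil_ring :: 'c list ring"
    using RDirProd_list_is_ring[of "[]"] by simp
  \<comment> \<open>The empty direct sum is the zero ring. Its single element is both 0 and 1, hence
    an exceptional unit, and the count 1 agrees with the empty product.\<close>
  have "exceptional_units (nil_ring :: 'c list ring) = {[]}"
    unfolding exceptional_units_eq_sum_one by (auto simp: Units_def monoid.defs)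
  then show ?case by simp
next
  case (Cons R Rs)
  have R: "ring R" and Rs: "\<And>i. i < length Rs \<Longrightarrow> ring (Rs ! i)"
    using Cons.prems[of 0] Cons.prems[of "Suc _"] by auto
  have ring_Rs: "ring (RDirProd_list Rs)"
    by (rule RDirProd_list_is_ring) (rule Rs)
  \<comment> \<open>The two rings are isomorphic but not equal: the elements are lists on one side
    and pairs on the other.\<close>
  have "card (exceptional_units (RDirProd_list (R # Rs))) =
      card (exceptional_units (RDirProd R (RDirProd_list Rs)))"
    by (rule card_exceptional_units_ring_iso[OF RDirProd_ring[OF R ring_Rs]
          RDirProd_list_is_ring RDirProd_list_iso1, symmetric])
      (rule Cons.prems)
  also have "\<dots> = card (exceptional_units R) * card (exceptional_units (RDirProd_list Rs))"
    by (simp add: exceptional_units_RDirProd[OF R ring_Rs] card_cartesian_product)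
  finally show ?case
    using Cons.IH[OF Rs] by (simp add: prod.lessThan_Suc_shift del: prod.lessThan_Suc)
qed

text \<open>Finiteness replaces Zorn's lemma: there are only finitely many proper ideals, so some
  inclusion-maximal one lies above \<open>I\<close>.\<close>

lemma (in ring) proper_ideal_subset_maximalideal:
  assumes fin: "finite (carrier R)" and I: "ideal I R" "I \<noteq> carrier R"
  shows "\<exists>J. maximalideal J R \<and> I \<subseteq> J"
proof -
  let ?A = "{J. ideal J R \<and> J \<noteq> carrier R}"
  have "?A \<subseteq> Pow (carrier R)"
    using additive_subgroup.a_subset[OF ideal.axioms(1)] by auto
  then have "finite ?A"
    using fin by (simp add: finite_subset)
  then obtain J where J: "J \<in> ?A" "I \<subseteq> J" and max: "\<And>K. K \<in> ?A \<Longrightarrow> J \<subseteq> K \<Longrightarrow> J = K"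
    using finite_has_maximal2[of ?A I] I by auto
  have "maximalideal J R"
  proof (rule maximalidealI)
    show "K = J \<or> K = carrier R" if "ideal K R" "J \<subseteq> K" "K \<subseteq> carrier R" for K
      using max[of K] that by auto
  qed (use J in auto)
  with J(2) show ?thesis by blast
qed

text \<open>A nonunit generates a proper ideal, which lies in a maximal ideal, and by locality that
  ideal is \<open>M\<close>. Conversely, a unit in \<open>M\<close> would put 1 into
  \<open>M\<close>.\<close>

lemma (in cring) finite_local_ring_Units:
  assumes loc: "local_ring R" and fin: "finite (carrier R)" and M: "maximalideal M R"
  shows "Units R = carrier R - M"
proof -
  interpret M: maximalideal M R by fact
  have "x \<in> M" if x: "x \<in> carrier R" "x \<notin> Units R" for x
  proof -
    \<comment> \<open>Otherwise 1 would be a multiple of \<open>x\<close>, and by commutativity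
      \<open>x\<close> would be a unit.\<close>
    have "\<one> \<notin> PIdl x"
      using x by (auto simp: cgenideal_def Units_def m_comm)
    then obtain J where J: "maximalideal J R" "PIdl x \<subseteq> J"
      using proper_ideal_subset_maximalideal[OF fin cgenideal_ideal[OF x(1)]] by blast
    moreover have "J = M"
      using loc M J(1) by (auto simp: local_ring_def)
    ultimately show ?thesis
      using cgenideal_self[OF x(1)] by blast
  qed
  moreover have "x \<notin> M" if x: "x \<in> Units R" for x
  proof
    assume "x \<in> M"
    then have "\<one> \<in> M"
      using M.I_l_closed[of x "inv x"] x by simp
    then show False
      using M.one_imp_carrier M.I_notcarr by simp
  qed
  ultimately show ?thesis
    by (intro equalityI subsetI) (auto simp only: Diff_iff)
qed

text \<open>The boundary case is a residue field with two elements: the two excluded cosets then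
  fill the whole ring, and both sides are 0.\<close>

lemma (in cring) card_exceptional_units_local_ring:
  assumes loc: "local_ring R" and fin: "finite (carrier R)" and M: "maximalideal M R"
  shows "int (card (exceptional_units R)) = int (card M) * (int (card (carrier (R Quot M))) - 2)"
proof -
  interpret M: maximalideal M R by fact
  have one: "\<one> \<notin> M"
    using M.one_imp_carrier M.I_notcarr by auto
  have M1: "M +> \<one> \<in> a_rcosets M"
    by (rule a_rcosetsI[OF M.a_subset one_closed])
  have M1_sub: "M +> \<one> \<subseteq> carrier R"
    using a_r_coset_subset_G[OF M.a_subset one_closed] .
  \<comment> \<open>This turns the condition that \<open>1 - u\<close> is a nonunit into membership
    of \<open>u\<close> in the coset of 1.\<close>
  have M1_iff: "u \<in> M +> \<one> \<longleftrightarrow> \<one> \<ominus> u \<in> M" if u: "u \<in> carrier R" for u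
  proof -
    have "u \<in> M +> \<one> \<longleftrightarrow> u \<ominus> \<one> \<in> M"
      by (rule M.a_rcos_module_minus[OF ring_axioms one_closed u])
    also have "\<dots> \<longleftrightarrow> \<one> \<ominus> u \<in> M"
      using u M.a_inv_closed[of "u \<ominus> \<one>"] M.a_inv_closed[of "\<one> \<ominus> u"]
      by (auto simp: a_minus_def minus_add a_comm)
    finally show ?thesis .
  qed
  have "exceptional_units R = carrier R - (M \<union> (M +> \<one>))"
    by (auto simp: exceptional_units_def finite_local_ring_Units[OF assms] M1_iff)
  \<comment> \<open>A common element \<open>u\<close> would give 1 = (1 - u) + u in
    \<open>M\<close>, although \<open>M\<close> is proper.\<close>
  moreover have disj: "M \<inter> (M +> \<one>) = {}"
  proof -
    have "\<one> \<in> M" if u: "u \<in> M" "\<one> \<ominus> u \<in> M" for u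
    proof -
      have "(\<one> \<ominus> u) \<oplus> u = \<one>"
        using M.Icarr[OF u(1)] by (simp add: a_minus_def a_assoc l_neg)
      with M.a_closed[OF u(2,1)] show ?thesis by simp
    qed
    with one show ?thesis by (auto simp: M1_iff M.Icarr)
  qed
  moreover have "card (M +> \<one>) = card M"
    by (rule a_card_cosets_equal[OF M1 M.a_subset fin])
  moreover have "finite M" "finite (M +> \<one>)"
    by (rule finite_subset[OF M.a_subset fin], rule finite_subset[OF M1_sub fin])
  \<comment> \<open>The inequality is recorded because subtraction of natural numbers truncates;
    with it the difference carries over to \<open>int\<close>.\<close>
  ultimately have "card (exceptional_units R) = card (carrier R) - (card M + card M)"
    and "card M + card M \<le> card (carrier R)"
    using card_Diff_subset[of "M \<union> (M +> \<one>)" "carrier R"] card_Un_disjoint[of M "M +> \<one>"]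
      card_mono[OF fin, of "M \<union> (M +> \<one>)"] M.a_subset M1_sub by auto
  \<comment> \<open>Lagrange's theorem for the additive group: the carrier of the quotient ring is
    the set of additive cosets of \<open>M\<close>.\<close>
  moreover have "card (carrier (R Quot M)) * card M = card (carrier R)"
    using a_lagrange[OF fin M.additive_subgroup_axioms] by (simp add: FactRing_def order_def)
  ultimately show ?thesis
    by (simp add: algebra_simps flip: of_nat_mult)
qed

text \<open>The local count needs each summand to be finite, while the theorem assumes this only of
  the whole ring. It follows because the coordinate projections are surjective.\<close>

lemma finite_carrier_RDirProd_list_component:
  assumes fin: "finite (carrier (RDirProd_list Rs))"
    and rings: "\<And>i. i < length Rs \<Longrightarrow> ring (Rs ! i)" and i: "i < length Rs"
  shows "finite (carrier (Rs ! i))"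
proof -
  have "carrier (Rs ! i) \<subseteq> (\<lambda>as. as ! i) ` carrier (RDirProd_list Rs)"
  proof
    fix x assume x: "x \<in> carrier (Rs ! i)"
    \<comment> \<open>A preimage of \<open>x\<close> under the projection: \<open>x\<close> in
      position \<open>i\<close> and zero in all others.\<close>
    let ?as = "(map (\<lambda>R. \<zero>\<^bsub>R\<^esub>) Rs)[i := x]"
    have "?as \<in> carrier (RDirProd_list Rs)"
      using x rings i by (intro RDirProd_list_carrier_memI) (auto simp: nth_list_update ring.ring_simprules(2))
    moreover have "x = ?as ! i"
      using i by simp
    ultimately show "x \<in> (\<lambda>as. as ! i) ` carrier (RDirProd_list Rs)" by blast
  qed
  then show ?thesis
    using fin finite_surj by blast
qed

theorem theorem1p4:
  fixes R :: "('a, 'm) ring_scheme"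
    and Rs :: "('b, 'n) ring_scheme list"
    and M :: "nat \<Rightarrow> 'b set"
  assumes "cring R"
    and "finite (carrier R)"
    and "R \<simeq> RDirProd_list Rs"
    and "\<And>i. i < length Rs \<Longrightarrow> local_ring (Rs ! i)"
    and "\<And>i. i < length Rs \<Longrightarrow> maximalideal (M i) (Rs ! i)"
  shows "int (card (exceptional_units R)) =
    (\<Prod>i<length Rs. int (card (M i)) * (int (card (carrier (Rs ! i Quot M i))) - 2))"
proof -
  have rings: "ring (Rs ! i)" if "i < length Rs" for i
    using assms(4)[OF that] by (simp add: local_ring_def cring_def)
  obtain h where h: "h \<in> ring_iso R (RDirProd_list Rs)"
    using assms(3) by (auto simp: is_ring_iso_def)
  have fin: "finite (carrier (RDirProd_list Rs))"
    using bij_betw_finite[OF ring_iso_memE(5)[OF h]] assms(2) by simp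
  \<comment> \<open>The local formula lives in \<open>int\<close>, whereas the product formula below
    counts in natural numbers and is cast to \<open>int\<close> before the factors are
    replaced.\<close>
  have local: "int (card (exceptional_units (Rs ! i))) =
      int (card (M i)) * (int (card (carrier (Rs ! i Quot M i))) - 2)" if i: "i < length Rs" for i
    using assms(4)[OF i]
    by (intro cring.card_exceptional_units_local_ring assms(5)[OF i]
        finite_carrier_RDirProd_list_component[OF fin rings i]) (simp_all add: local_ring_def)
  have "card (exceptional_units R) = card (exceptional_units (RDirProd_list Rs))"
    using card_exceptional_units_ring_iso[OF cring.axioms(1)[OF assms(1)] RDirProd_list_is_ring h] rings
    by blast
  also have "\<dots> = (\<Prod>i<length Rs. card (exceptional_units (Rs ! i)))"
    by (rule card_exceptional_units_RDirProd_list) (rule rings)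
  finally have "int (card (exceptional_units R)) =
      (\<Prod>i<length Rs. int (card (exceptional_units (Rs ! i))))"
    by simp
  also have "\<dots> = (\<Prod>i<length Rs. int (card (M i)) * (int (card (carrier (Rs ! i Quot M i))) - 2))"
    using local by (intro prod.cong) auto
  finally show ?thesis .
qed

end
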